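(* Let $p$ be a prime and $r\ge1$ an integer. If $f,g\in\mathbb{Q}[x]$ are $p^r$-pure with $\deg(f)>1$, then $f\circ g$ is $p^r$-pure.
   Context: $\nu_p$ denotes the $p$-adic valuation on $\mathbb{Q}$ (with $\nu_p(0)=\infty$). A polynomial $q(x)=a_nx^n+\dots+a_0\in\mathbb{Q}[x]$ of degree $n$ is $p^r$-pure if $\nu_p(a_n)=0$, $\nu_p(a_0)=r$, and $\frac{\nu_p(a_i)}{n-i}\ge\frac{r}{n}$ for all $1\le i\le n-1$. *)

theory Defs
  imports "HOL-Computational_Algebra.Computational_Algebra" "HOL-Library.Extended_Real"
begin

text \<open>The \<open>p\<close>-adic valuation on the rationals, via the reduced fraction \<open>(num, den)\<close>
  returned by \<^const>\<open>quotient_of\<close>. The case distinction is needed because the library sets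
  \<open>multiplicity p 0 = 0\<close>.\<close>

definition padic_val :: "nat \<Rightarrow> rat \<Rightarrow> ereal" where
  "padic_val p x =
     (if x = 0 then \<infinity>
      else ereal (real (multiplicity (int p) (fst (quotient_of x)))
                  - real (multiplicity (int p) (snd (quotient_of x)))))"

definition pure_poly :: "nat \<Rightarrow> nat \<Rightarrow> rat poly \<Rightarrow> bool" where
  "pure_poly p r q \<longleftrightarrow>
     padic_val p (lead_coeff q) = 0 \<and>
     padic_val p (coeff q 0) = ereal (real r) \<and>
     (\<forall>i. 1 \<le> i \<and> i < degree q \<longrightarrow>
        padic_val p (coeff q i) / ereal (real (degree q) - real i)
          \<ge> ereal (real r / real (degree q)))"

end

theory Submission
  imports Defs
begin

text \<open>Write \<open>n = degree f\<close>, \<open>m = degree g\<close>. Purity says that the Newton polygon lies above a line: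
  \<open>\<nu>(coeff g i) \<ge> r (1 - i/m)\<close> for all \<open>i\<close>. Such bounds are multiplicative, so the coefficient of
  \<open>x^i\<close> in \<open>a\<^sub>j g^j\<close> has valuation at least \<open>r (1 - j/n) + r (j - i/m)\<close>, which exceeds
  \<open>r (1 - i/(nm))\<close> by \<open>r (n - 1) (jm - i) / (nm)\<close>; this is nonnegative unless \<open>i > jm\<close>, and then the
  coefficient vanishes. For \<open>i = 0\<close> and \<open>j \<ge> 1\<close> the bound is at least \<open>r + r (1 - 1/n) > r\<close>,
  so the constant coefficient has the valuation of \<open>a\<^sub>0\<close>.\<close>

section \<open>The valuation on the rationals\<close>

lemma padic_val_0 [simp]: "padic_val p 0 = \<infinity>"
  by (simp add: padic_val_def)

text \<open>Independence of the fraction chosen: comparison with the reduced one gives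
  \<open>a * d = n * b\<close>, and multiplicities of a prime add. Sums and products can then be
  evaluated on unreduced fractions.\<close>

lemma padic_val_of_int_divide:
  assumes "prime p" "a \<noteq> 0" "b \<noteq> 0"
  shows "padic_val p (of_int a / of_int b)
           = ereal (real (multiplicity (int p) a) - real (multiplicity (int p) b))"
proof -
  define x where "x = (of_int a / of_int b :: rat)"
  obtain n d where nd: "quotient_of x = (n, d)" by fastforce
  have d: "d > 0" using quotient_of_denom_pos[OF nd] .
  have x: "x = of_int n / of_int d" using quotient_of_div[OF nd] .
  have x0: "x \<noteq> 0" using assms by (simp add: x_def)
  then have n: "n \<noteq> 0" using x by auto
  have "of_int (a * d) = (of_int (n * b) :: rat)"
    using x d assms by (simp add: x_def field_simps)
  then have "a * d = n * b" by linarith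
  then have "multiplicity (int p) (a * d) = multiplicity (int p) (n * b)" by simp
  then have "multiplicity (int p) a + multiplicity (int p) d
      = multiplicity (int p) n + multiplicity (int p) b"
    using assms n d by (simp add: prime_elem_multiplicity_mult_distrib)
  then have "real (multiplicity (int p) a) - real (multiplicity (int p) b)
      = real (multiplicity (int p) n) - real (multiplicity (int p) d)"
    by linarith
  then show ?thesis
    using x0 nd by (simp add: padic_val_def flip: x_def)
qed

lemma rat_nonzero_as_fraction:
  fixes x :: rat
  assumes "x \<noteq> 0"
  obtains a b where "x = of_int a / of_int b" "a \<noteq> 0" "b \<noteq> 0"
proof -
  obtain n d where nd: "quotient_of x = (n, d)" by fastforce
  show thesis
    using that[of n d] quotient_of_denom_pos[OF nd] quotient_of_div[OF nd] assms by auto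
qed

lemma padic_val_1:
  assumes "prime p"
  shows "padic_val p 1 = 0"
  using padic_val_of_int_divide[of p 1 1] assms by (simp add: zero_ereal_def)

lemma padic_val_mult:
  assumes "prime p"
  shows "padic_val p (x * y) = padic_val p x + padic_val p y"
proof (cases "x = 0 \<or> y = 0")
  case True
  then show ?thesis by auto
next
  case False
  obtain a b where x: "x = of_int a / of_int b" "a \<noteq> 0" "b \<noteq> 0"
    using rat_nonzero_as_fraction False by blast
  obtain c d where y: "y = of_int c / of_int d" "c \<noteq> 0" "d \<noteq> 0"
    using rat_nonzero_as_fraction False by blast
  have "x * y = of_int (a * c) / of_int (b * d)"
    by (simp add: x y)
  then have "padic_val p (x * y) = ereal (real (multiplicity (int p) (a * c))
      - real (multiplicity (int p) (b * d)))"
    using padic_val_of_int_divide[OF assms, of "a * c" "b * d"] x y by simp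
  then show ?thesis
    using assms x y
    by (simp add: padic_val_of_int_divide prime_elem_multiplicity_mult_distrib)
qed

lemma padic_val_power:
  assumes "prime p" "padic_val p x = ereal t"
  shows "padic_val p (x ^ n) = ereal (real n * t)"
  by (induction n)
    (use assms in \<open>simp_all add: padic_val_1 padic_val_mult zero_ereal_def algebra_simps\<close>)

lemma padic_val_minus:
  assumes "prime p"
  shows "padic_val p (- x) = padic_val p x"
proof -
  have "padic_val p (-1) = 0"
    using padic_val_of_int_divide[OF assms, of "-1" 1] by (simp add: zero_ereal_def)
  then show ?thesis
    using padic_val_mult[OF assms, of "-1" x] by simp
qed

lemma padic_val_add_ge_min:
  assumes "prime p"
  shows "min (padic_val p x) (padic_val p y) \<le> padic_val p (x + y)"
proof (cases "x = 0 \<or> y = 0 \<or> x + y = 0")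
  case True
  then show ?thesis by auto
next
  case False
  obtain a b where x: "x = of_int a / of_int b" "a \<noteq> 0" "b \<noteq> 0"
    using rat_nonzero_as_fraction False by blast
  obtain c d where y: "y = of_int c / of_int d" "c \<noteq> 0" "d \<noteq> 0"
    using rat_nonzero_as_fraction False by blast
  let ?\<mu> = "multiplicity (int p)"
  have xy: "x + y = of_int (a * d + c * b) / of_int (b * d)"
    using x y by (simp add: field_simps)
  \<comment> \<open>Divisibility by a power bounds \<open>multiplicity\<close> from below only for a
    nonzero number.\<close>
  then have nz: "a * d + c * b \<noteq> 0"
    using False by (metis div_0 of_int_0)
  have "int p ^ min (?\<mu> (a * d)) (?\<mu> (c * b)) dvd a * d + c * b"
    by (intro dvd_add) (simp_all add: multiplicity_dvd')
  then have "min (?\<mu> (a * d)) (?\<mu> (c * b)) \<le> ?\<mu> (a * d + c * b)"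
    using nz assms by (intro multiplicity_geI) (auto dest: prime_gt_1_nat)
  then have "min (?\<mu> a + ?\<mu> d) (?\<mu> c + ?\<mu> b) \<le> ?\<mu> (a * d + c * b)"
    using assms x y by (simp add: prime_elem_multiplicity_mult_distrib)
  moreover have "padic_val p (x + y)
      = ereal (real (?\<mu> (a * d + c * b)) - real (?\<mu> b + ?\<mu> d))"
    using padic_val_of_int_divide[OF assms nz, of "b * d"] assms x(2,3) y(2,3)
    by (simp add: xy[symmetric] prime_elem_multiplicity_mult_distrib del: of_int_add of_int_mult)
  ultimately show ?thesis
    using padic_val_of_int_divide[OF assms x(2,3)] padic_val_of_int_divide[OF assms y(2,3)] x y
    by (auto simp: min_le_iff_disj)
qed

lemma padic_val_sum_ge:
  assumes "prime p" "\<And>i. i \<in> A \<Longrightarrow> c \<le> padic_val p (h i)"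
  shows "c \<le> padic_val p (sum h A)"
  using assms(2)
\<comment> \<open>For infinite or empty \<open>A\<close> the sum is 0, of valuation
  \<infinity>.\<close>
proof (induction A rule: infinite_finite_induct)
  case (insert i A)
  then have "c \<le> min (padic_val p (h i)) (padic_val p (sum h A))" by simp
  also have "\<dots> \<le> padic_val p (h i + sum h A)" by (rule padic_val_add_ge_min[OF assms(1)])
  finally show ?case using insert by simp
qed auto

lemma padic_val_add_eq:
  assumes "prime p" "padic_val p x < padic_val p y"
  shows "padic_val p (x + y) = padic_val p x"
proof (rule antisym)
  \<comment> \<open>Recover \<open>x\<close> from \<open>x + y\<close>: the minimum cannot be the
    valuation of \<open>y\<close>, which exceeds that of \<open>x\<close>.\<close>
  have "min (padic_val p (x + y)) (padic_val p (- y)) \<le> padic_val p ((x + y) + - y)"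
    by (rule padic_val_add_ge_min[OF assms(1)])
  then show "padic_val p (x + y) \<le> padic_val p x"
    using assms by (auto simp: padic_val_minus min_le_iff_disj)
  show "padic_val p x \<le> padic_val p (x + y)"
    using padic_val_add_ge_min[OF assms(1), of x y] assms(2) by simp
qed

section \<open>Linear lower bounds on coefficients\<close>

lemma padic_val_mult_ge:
  assumes "prime p" "ereal s \<le> padic_val p x" "ereal t \<le> padic_val p y"
  shows "ereal (s + t) \<le> padic_val p (x * y)"
  using add_mono[OF assms(2,3)] by (simp add: padic_val_mult[OF assms(1)])

text \<open>The bounding lines share the slope \<open>-s\<close> and vanish at \<open>k\<close> and
  \<open>l\<close>. In each convolution term the two indices add up to \<open>i\<close>, so the
  zeros of the lines add as well.\<close>

lemma padic_val_coeff_mult_ge: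
  assumes "prime p"
    and "\<And>i. ereal (s * (k - real i)) \<le> padic_val p (coeff u i)"
    and "\<And>i. ereal (s * (l - real i)) \<le> padic_val p (coeff w i)"
  shows "ereal (s * (k + l - real i)) \<le> padic_val p (coeff (u * w) i)"
  unfolding coeff_mult
proof (rule padic_val_sum_ge[OF assms(1)])
  fix j assume "j \<in> {..i}"
  then have "s * (k + l - real i) = s * (k - real j) + s * (l - real (i - j))"
    by (simp add: of_nat_diff algebra_simps)
  then show "ereal (s * (k + l - real i)) \<le> padic_val p (coeff u j * coeff w (i - j))"
    using padic_val_mult_ge[OF assms(1) assms(2)[of j] assms(3)[of "i - j"]] by simp
qed

lemma padic_val_coeff_power_ge:
  assumes "prime p" "s \<ge> 0"
    and "\<And>i. ereal (s * (k - real i)) \<le> padic_val p (coeff u i)"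
  shows "ereal (s * (real n * k - real i)) \<le> padic_val p (coeff (u ^ n) i)"
proof (induction n arbitrary: i)
  case 0
  have "s * (0 - real i) \<le> 0"
    using assms(2) by simp
  then show ?case
    by (simp add: coeff_1 padic_val_1[OF assms(1)] zero_ereal_def)
next
  case (Suc n)
  show ?case
    using padic_val_coeff_mult_ge[OF assms(1) assms(3) Suc, of i] by (simp add: algebra_simps)
qed

text \<open>Clearing the positive denominator \<open>degree q - i\<close> gives a line through the
  points with abscissae 0 and \<open>degree q\<close>. At these ends the bound follows from the
  other two conditions; beyond the degree the coefficients vanish. A bound for every
  \<open>i\<close> is the form that products preserve.\<close>

lemma pure_poly_iff:
  assumes "degree q > 0"
  shows "pure_poly p r q \<longleftrightarrow>
    padic_val p (lead_coeff q) = 0 \<and> padic_val p (coeff q 0) = ereal (real r) \<and>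
    (\<forall>i. ereal (real r / real (degree q) * (real (degree q) - real i)) \<le> padic_val p (coeff q i))"
    (is "_ \<longleftrightarrow> ?lc \<and> ?c0 \<and> (\<forall>i. ?bound i)")
proof -
  have slope: "ereal (real r / real (degree q))
        \<le> padic_val p (coeff q i) / ereal (real (degree q) - real i) \<longleftrightarrow> ?bound i"
    if "i < degree q" for i
    using that
    by (subst ereal_le_divide_pos) (auto simp: mult.commute)
  have "?bound i" if hyps: ?lc ?c0 "i = 0 \<or> degree q \<le> i" for i
  proof -
    consider "i = 0" | "i = degree q" | "i > degree q" using hyps(3) by linarith
    then show ?thesis
      using hyps assms by cases (auto simp: coeff_eq_0 zero_ereal_def)
  qed
  moreover have "i = 0 \<or> degree q \<le> i" if "\<not> (1 \<le> i \<and> i < degree q)" for i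
    using that by linarith
  ultimately show ?thesis
    unfolding pure_poly_def using slope by blast
qed

text \<open>For a constant, one coefficient would have valuation both 0 and
  \<open>r\<close>.\<close>

lemma pure_poly_degree_pos:
  assumes "pure_poly p r q" "r \<ge> 1"
  shows "degree q > 0"
proof (rule ccontr)
  assume "\<not> degree q > 0"
  then have "lead_coeff q = coeff q 0" by simp
  then have "0 = ereal (real r)"
    using assms(1) unfolding pure_poly_def by metis
  then show False using assms(2) by simp
qed

section \<open>Coefficients of the composition\<close>

lemma coeff_pcompose_sum:
  "coeff (f \<circ>\<^sub>p g) i = (\<Sum>j\<le>degree f. coeff f j * coeff (g ^ j) i)"
proof -
  have "degree (map_poly (\<lambda>x. [:x:]) f) = degree f"
    by (rule degree_map_poly) simp
  then show ?thesis
    by (simp add: pcompose_altdef poly_altdef coeff_sum coeff_map_poly)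
qed

theorem theorem3p10:
  fixes p r :: nat and f g :: "rat poly"
  assumes "prime p"
    and "r \<ge> 1"
    and "pure_poly p r f"
    and "pure_poly p r g"
    and "degree f > 1"
  shows "pure_poly p r (f \<circ>\<^sub>p g)"
proof -
  define n m where "n = degree f" and "m = degree g"
  have m: "m > 0" and n: "n > 1"
    using pure_poly_degree_pos[OF assms(4,2)] assms(5) by (auto simp: n_def m_def)
  have deg: "degree (f \<circ>\<^sub>p g) = n * m"
    by (simp add: n_def m_def degree_pcompose)
  have f: "padic_val p (lead_coeff f) = 0" "padic_val p (coeff f 0) = ereal (real r)"
      "\<And>j. ereal (real r / real n * (real n - real j)) \<le> padic_val p (coeff f j)"
    using assms(3,5) by (auto simp: pure_poly_iff n_def)
  have g: "padic_val p (lead_coeff g) = 0" "padic_val p (coeff g 0) = ereal (real r)"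
      "\<And>i. ereal (real r / real m * (real m - real i)) \<le> padic_val p (coeff g i)"
    using assms(4) m by (auto simp: pure_poly_iff m_def)
  \<comment> \<open>The second summand is the power bound for \<open>g ^ j\<close> with
    \<open>s = r / m\<close> and \<open>k = m\<close>.\<close>
  have term_ge: "ereal (real r / real n * (real n - real j)
        + real r / real m * (real j * real m - real i)) \<le> padic_val p (coeff f j * coeff (g ^ j) i)"
    for i j
    by (intro padic_val_mult_ge padic_val_coeff_power_ge f g assms(1)) auto
  \<comment> \<open>The term bound is the target line plus a surplus with the sign of
    \<open>j * m - i\<close>.\<close>
  have excess: "real r / real n * (real n - real j) + real r / real m * (real j * real m - real i)
      = real r / real (n * m) * (real (n * m) - real i)
        + real r * (real n - 1) / real (n * m) * (real (j * m) - real i)" for i j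
    using m n by (simp add: field_simps)
  have lc: "padic_val p (lead_coeff (f \<circ>\<^sub>p g)) = 0"
  proof -
    have "padic_val p (lead_coeff g ^ n) = 0"
      using padic_val_power[OF assms(1), of "lead_coeff g" 0] g(1) by (simp add: zero_ereal_def)
    then show ?thesis
      using m f(1) by (simp add: lead_coeff_comp m_def n_def padic_val_mult[OF assms(1)])
  qed
  have bound: "ereal (real r / real (n * m) * (real (n * m) - real i))
      \<le> padic_val p (coeff (f \<circ>\<^sub>p g) i)" for i
    unfolding coeff_pcompose_sum
  proof (rule padic_val_sum_ge[OF assms(1)])
    fix j
    show "ereal (real r / real (n * m) * (real (n * m) - real i))
        \<le> padic_val p (coeff f j * coeff (g ^ j) i)"
    proof (cases "i \<le> j * m")
      case True
      then have "0 \<le> real r * (real n - 1) / real (n * m) * (real (j * m) - real i)"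
        using n by (intro mult_nonneg_nonneg divide_nonneg_nonneg) (auto simp flip: of_nat_mult)
      then have "real r / real (n * m) * (real (n * m) - real i)
          \<le> real r / real n * (real n - real j) + real r / real m * (real j * real m - real i)"
        unfolding excess by linarith
      then show ?thesis
        by (intro order_trans[OF _ term_ge[of j i]]) (simp only: ereal_less_eq)
    next
      case False
      then have "degree (g ^ j) < i"
        using degree_power_le[of g j] by (simp add: m_def mult.commute)
      then show ?thesis by (simp add: coeff_eq_0)
    qed
  qed
  have c0: "padic_val p (coeff (f \<circ>\<^sub>p g) 0) = ereal (real r)"
  proof -
    \<comment> \<open>The omitted term \<open>j = 0\<close> is \<open>coeff f 0\<close>, since
      \<open>g ^ 0 = 1\<close>.\<close>
    define S where "S = (\<Sum>j=1..n. coeff f j * coeff (g ^ j) 0)"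
    have split: "coeff (f \<circ>\<^sub>p g) 0 = coeff f 0 + S"
      unfolding coeff_pcompose_sum S_def n_def
      by (simp add: atMost_atLeast0 sum.atLeast_Suc_atMost)
    have "ereal (real r + real r * (1 - 1 / real n)) \<le> padic_val p S"
      unfolding S_def
    proof (rule padic_val_sum_ge[OF assms(1)])
      fix j assume "j \<in> {1..n}"
      \<comment> \<open>At \<open>i = 0\<close> the term bound is
        \<open>r + r * (1 - 1 / n) * j\<close>, smallest at \<open>j = 1\<close>.\<close>
      then have "real r * (1 - 1 / real n) * 1 \<le> real r * (1 - 1 / real n) * real j"
        using n by (intro mult_left_mono) auto
      moreover have "real r + real r * (1 - 1 / real n) * real j
          = real r / real n * (real n - real j) + real r / real m * (real j * real m - real 0)"
        using m n by (simp add: field_simps)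
      ultimately have "real r + real r * (1 - 1 / real n)
          \<le> real r / real n * (real n - real j) + real r / real m * (real j * real m - real 0)"
        by linarith
      then show "ereal (real r + real r * (1 - 1 / real n))
          \<le> padic_val p (coeff f j * coeff (g ^ j) 0)"
        by (intro order_trans[OF _ term_ge[of j 0]]) (simp only: ereal_less_eq)
    qed
    \<comment> \<open>Here \<open>n > 1\<close> is essential: for \<open>n = 1\<close> both
      \<open>coeff f 0\<close> and \<open>S\<close> would have valuation \<open>r\<close>, and their
      sum could have a larger one.\<close>
    moreover have "0 < real r * (1 - 1 / real n)"
      using n assms(2) by simp
    then have "padic_val p (coeff f 0) < ereal (real r + real r * (1 - 1 / real n))"
      unfolding f(2) less_ereal.simps by linarith
    ultimately have "padic_val p (coeff f 0) < padic_val p S"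
      by (rule less_le_trans[rotated])
    then show ?thesis
      unfolding split using padic_val_add_eq[OF assms(1)] f(2) by metis
  qed
  have "degree (f \<circ>\<^sub>p g) > 0"
    using m n by (simp add: deg)
  then show ?thesis
    using lc c0 bound by (subst pure_poly_iff) (auto simp only: deg)
qed

end
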